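(* Let $X$ be a reflexive Banach space such that for every $x \in X$ with $x \neq 0$ the set $$\{x^* \in X^* : \|x^*\| = 1 \text{ and } x^*(x) = \|x\|\}$$ is compact (in the norm topology of $X^*$). Let $T_1, T_2, \dots, T_N$ be $N$ $(W)$-contractions on $X$ and let $\mathbf{S} = S(T_1,\dots,T_N)$ be the semigroup generated by $\{T_1,\dots,T_N\}$. Then $\mathbf{S}$ has property $(W)$. Hence every random product $\{S_n\}$ drawn from $\{T_1,\dots,T_N\}$ converges weakly, i.e. for every $x \in X$ the sequence $\{S_n x\}$ converges weakly in $X$.
   Context: A contraction on a Banach space $X$ is a bounded linear operator $T: X \to X$ with $\|Tx\| \le \|x\|$ for all $x \in X$. A contraction $T$ satisfies condition $(W)$ (is a $(W)$-contraction) if, whenever $\{x_n\}$ is a bounded sequence in $X$ with $\|x_n\| - \|T x_n\| \to 0$, the sequence $x_n - T x_n$ converges weakly to $0$. $S(T_1,\dots,T_N)$ denotes the algebraic semigroup generated by $T_1,\dots,T_N$ under composition; its elements (words) are finite products of the $T_j$'s. A semigroup $\mathbf{S}$ generated by contractions on $X$ has property (condition) $(W)$ if for every bounded sequence $\{x_n\} \subseteq X$ and every sequence of words $\{W_n\}$ from $\mathbf{S}$ with $\|x_n\| - \|W_n x_n\| \to 0$, the sequence $x_n - W_n x_n$ converges weakly to $0$. A random (or unrestricted) product drawn from $\{T_1,\dots,T_N\}$ is a sequence $\{S_n\}_{n\ge 1}$ of operators $S_n = T_{r(n)} T_{r(n-1)} \cdots T_{r(1)}$, where $r: \mathbb{N}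 \to \{1,\dots,N\}$ is a mapping onto $\{1,\dots,N\}$ that assumes each value infinitely often. *)

theory Defs
  imports "HOL-Analysis.Analysis"
begin

text \<open>The continuous dual of \<open>'a\<close> is \<open>'a \<Rightarrow>\<^sub>L real\<close>, normed by the operator norm.\<close>

text \<open>Surjectivity of the canonical embedding into the bidual.\<close>

definition reflexive_space :: "'a::real_normed_vector itself \<Rightarrow> bool" where
  "reflexive_space _ \<longleftrightarrow>
     (\<forall>\<phi> :: ('a \<Rightarrow>\<^sub>L real) \<Rightarrow>\<^sub>L real. \<exists>x::'a. \<forall>f. blinfun_apply \<phi> f = blinfun_apply f x)"

definition norming_functionals :: "'a::real_normed_vector \<Rightarrow> ('a \<Rightarrow>\<^sub>L real) set" where
  "norming_functionals x = {f. norm f = 1 \<and> blinfun_apply f x = norm x}"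

definition weakly_converges_to :: "(nat \<Rightarrow> 'a::real_normed_vector) \<Rightarrow> 'a \<Rightarrow> bool" where
  "weakly_converges_to x l \<longleftrightarrow>
     (\<forall>f :: 'a \<Rightarrow>\<^sub>L real. (\<lambda>n. blinfun_apply f (x n)) \<longlonglongrightarrow> blinfun_apply f l)"

definition contraction :: "('a::real_normed_vector \<Rightarrow>\<^sub>L 'a) \<Rightarrow> bool" where
  "contraction T \<longleftrightarrow> (\<forall>x. norm (blinfun_apply T x) \<le> norm x)"

definition W_contraction :: "('a::real_normed_vector \<Rightarrow>\<^sub>L 'a) \<Rightarrow> bool" where
  "W_contraction T \<longleftrightarrow> contraction T \<and>
     (\<forall>x :: nat \<Rightarrow> 'a. bounded (range x) \<longrightarrow>
        (\<lambda>n. norm (x n) - norm (blinfun_apply T (x n))) \<longlonglongrightarrow> 0 \<longrightarrow>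
        weakly_converges_to (\<lambda>n. x n - blinfun_apply T (x n)) 0)"

text \<open>Words are nonempty products, so the identity belongs to the semigroup only if it is
  itself a product of generators.\<close>

inductive_set generated_semigroup ::
    "('a::real_normed_vector \<Rightarrow>\<^sub>L 'a) set \<Rightarrow> ('a \<Rightarrow>\<^sub>L 'a) set"
  for G where
  generator: "T \<in> G \<Longrightarrow> T \<in> generated_semigroup G"
| compose: "A \<in> generated_semigroup G \<Longrightarrow> B \<in> generated_semigroup G \<Longrightarrow>
     A o\<^sub>L B \<in> generated_semigroup G"

definition property_W :: "('a::real_normed_vector \<Rightarrow>\<^sub>L 'a) set \<Rightarrow> bool" where
  "property_W \<S> \<longleftrightarrow>
     (\<forall>(x :: nat \<Rightarrow> 'a) W. bounded (range x) \<longrightarrow> (\<forall>n. W n \<in> \<S>) \<longrightarrow>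
        (\<lambda>n. norm (x n) - norm (blinfun_apply (W n) (x n))) \<longlonglongrightarrow> 0 \<longrightarrow>
        weakly_converges_to (\<lambda>n. x n - blinfun_apply (W n) (x n)) 0)"

text \<open>\<open>iterated_product T r n\<close> is \<open>T (r n) \<circ> \<dots> \<circ> T (r 1)\<close>; the value \<open>r 0\<close> is never used.\<close>

primrec iterated_product ::
    "(nat \<Rightarrow> 'a::real_normed_vector \<Rightarrow>\<^sub>L 'a) \<Rightarrow> (nat \<Rightarrow> nat) \<Rightarrow> nat \<Rightarrow> 'a \<Rightarrow>\<^sub>L 'a" where
  "iterated_product T r 0 = id_blinfun"
| "iterated_product T r (Suc n) = T (r (Suc n)) o\<^sub>L iterated_product T r n"

text \<open>The sequence \<open>S\<close> is indexed from 1, so \<open>S 0\<close> is left unconstrained.\<close>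

definition random_product ::
    "nat \<Rightarrow> (nat \<Rightarrow> 'a::real_normed_vector \<Rightarrow>\<^sub>L 'a) \<Rightarrow> (nat \<Rightarrow> 'a \<Rightarrow>\<^sub>L 'a) \<Rightarrow> bool" where
  "random_product N T S \<longleftrightarrow>
     (\<exists>r :: nat \<Rightarrow> nat. r ` {1..} = {1..N} \<and>
        (\<forall>j\<in>{1..N}. infinite {n \<in> {1..}. r n = j}) \<and>
        (\<forall>n\<ge>1. S n = iterated_product T r n))"

end

theory Submission
  imports Defs
begin

text \<open>Amemiya--Ando induction on the number of generators. If \<open>norm (x n) - norm (W n (x n))\<close> tends
  to \<open>0\<close> and the words \<open>W n\<close> contain every generator, cutting \<open>W n\<close> at the first and at the last
  occurrence of a generator \<open>T\<close> shows, by the induction hypothesis, that \<open>x n\<close> and \<open>W n (x n)\<close> are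
  asymptotically fixed by \<open>T\<close>, so their weak cluster points \<open>l\<close> and \<open>m\<close> are common fixed points.
  The compact set of norming functionals of \<open>l - m\<close> is invariant under the adjoints of the \<open>W n\<close>,
  which forces \<open>l = m\<close>. Cluster points are taken along refining filters, so Tychonoff's theorem
  replaces the Eberlein--Smulian theorem. Property (W) makes the orbit of a random product weakly
  Cauchy, and reflexivity supplies the weak limit.\<close>

section \<open>Hahn--Banach\<close>

text \<open>Only an inequality for positive factors is required, so that the infima below are easy
  to check. Equality returns on applying it once more with the factor \<open>1 / c\<close>.\<close>

definition sublinear :: "('a::real_vector \<Rightarrow> real) \<Rightarrow> bool" where
  "sublinear q \<longleftrightarrow> (\<forall>x y. q (x + y) \<le> q x + q y) \<and> (\<forall>c>0. \<forall>x. q (c *\<^sub>R x) \<le> c * q x)"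

lemma sublinear_add: "sublinear q \<Longrightarrow> q (x + y) \<le> q x + q y"
  by (simp add: sublinear_def)

lemma sublinear_scaleR:
  assumes "sublinear q" "c > 0"
  shows "q (c *\<^sub>R x) = c * q x"
proof (rule antisym)
  show "q (c *\<^sub>R x) \<le> c * q x"
    using assms by (simp add: sublinear_def)
  have "q ((1 / c) *\<^sub>R (c *\<^sub>R x)) \<le> (1 / c) * q (c *\<^sub>R x)"
    using assms by (metis sublinear_def zero_less_divide_1_iff)
  then show "c * q x \<le> q (c *\<^sub>R x)"
    using assms(2) by (simp add: field_simps)
qed

lemma sublinear_zero: "sublinear q \<Longrightarrow> q 0 = 0"
  using sublinear_scaleR[of q 2 0] by simp

lemma sublinear_ge_minus: "sublinear q \<Longrightarrow> - q (- x) \<le> q x"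
  using sublinear_add[of q x "- x"] sublinear_zero[of q] by simp

lemma sublinear_norm: "sublinear norm"
  by (simp add: sublinear_def norm_triangle_ineq)

text \<open>The bound \<open>- p (- x)\<close>, common to all members, keeps the infimum finite.
  Subadditivity survives because of two members of a chain the smaller one serves both arguments at
  once.\<close>

lemma sublinear_INF_chain:
  assumes "C \<noteq> {}" and sub: "\<And>g. g \<in> C \<Longrightarrow> sublinear g \<and> g \<le> p"
    and chain: "\<And>g h. g \<in> C \<Longrightarrow> h \<in> C \<Longrightarrow> g \<le> h \<or> h \<le> g"
  shows "sublinear (\<lambda>x. INF g\<in>C. g x) \<and> (\<forall>g\<in>C. (\<lambda>x. INF g\<in>C. g x) \<le> g)"
proof -
  let ?m = "\<lambda>x. INF g\<in>C. g x"
  have bdd: "bdd_below ((\<lambda>g. g x) ` C)" for x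
  proof (rule bdd_belowI2)
    fix g assume "g \<in> C"
    then have "- g (- x) \<le> g x" "g (- x) \<le> p (- x)"
      using sub sublinear_ge_minus by (auto simp: le_fun_def)
    then show "- p (- x) \<le> g x" by linarith
  qed
  have le: "?m x \<le> g x" if "g \<in> C" for g x
    using bdd that by (rule cINF_lower)
  have add: "?m (x + y) \<le> g x + h y" if gh: "g \<in> C" "h \<in> C" for g h x y
  proof -
    obtain k where k: "k \<in> C" "k x \<le> g x" "k y \<le> h y"
      using chain[OF gh] gh by (auto simp: le_fun_def)
    have "?m (x + y) \<le> k x + k y"
      using le[OF k(1), of "x + y"] sublinear_add[of k x y] sub[OF k(1)] by linarith
    then show ?thesis using k by linarith
  qed
  have "?m (x + y) \<le> ?m x + ?m y" for x y
  proof -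
    have "?m (x + y) - g x \<le> ?m y" if "g \<in> C" for g
      using assms(1) add[OF that] by (intro cINF_greatest) (auto simp: algebra_simps)
    then have "?m (x + y) - ?m y \<le> ?m x"
      using assms(1) by (intro cINF_greatest) (auto simp: algebra_simps)
    then show ?thesis by simp
  qed
  moreover have "?m (c *\<^sub>R x) \<le> c * ?m x" if "c > 0" for c x
  proof -
    have "?m (c *\<^sub>R x) / c \<le> ?m x"
    proof (rule cINF_greatest[OF assms(1)])
      fix g assume g: "g \<in> C"
      have "?m (c *\<^sub>R x) \<le> c * g x"
        using le[OF g, of "c *\<^sub>R x"] sublinear_scaleR[of g c x] sub[OF g] that by simp
      then show "?m (c *\<^sub>R x) / c \<le> g x"
        using that by (simp add: field_simps)
    qed
    then show ?thesis using that by (simp add: field_simps)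
  qed
  ultimately show ?thesis
    using le by (auto simp: sublinear_def le_fun_def)
qed

text \<open>The witness is the largest sublinear functional below \<open>q\<close> with value at most \<open>- q y\<close>
  at \<open>- y\<close>.\<close>

lemma sublinear_decrease:
  assumes q: "sublinear q"
  shows "\<exists>q'. sublinear q' \<and> q' \<le> q \<and> (\<forall>x. q' x \<le> q (x + y) - q y)"
proof -
  \<comment> \<open>The correction \<open>t * q y\<close> is exactly
    \<open>q (t *\<^sub>R y)\<close>, so subadditivity of \<open>q\<close> bounds every term below
    by \<open>- q (- x)\<close>.\<close>
  define q' where "q' x = (INF t\<in>{0..}. q (x + t *\<^sub>R y) - t * q y)" for x
  have scale: "q (t *\<^sub>R y) = t * q y" if "t \<ge> 0" for t
    using that sublinear_scaleR[OF q, of t y] sublinear_zero[OF q] by (cases "t = 0") auto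
  have bdd: "bdd_below ((\<lambda>t. q (x + t *\<^sub>R y) - t * q y) ` {0..})" for x
  proof (rule bdd_belowI2)
    fix t :: real assume "t \<in> {0..}"
    then show "- q (- x) \<le> q (x + t *\<^sub>R y) - t * q y"
      using sublinear_add[OF q, of "x + t *\<^sub>R y" "- x"] scale[of t] by simp
  qed
  have le: "q' x \<le> q (x + t *\<^sub>R y) - t * q y" if "t \<ge> 0" for x t
    unfolding q'_def using bdd that by (intro cINF_lower) auto
  have ge: "a \<le> q' x" if "\<And>t. t \<ge> 0 \<Longrightarrow> a \<le> q (x + t *\<^sub>R y) - t * q y" for a x
    unfolding q'_def using that by (intro cINF_greatest) auto
  have add: "q' (u + v) \<le> q' u + q' v" for u v
  proof -
    \<comment> \<open>Two parameters \<open>s\<close> and \<open>t\<close> merge into the single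
      admissible parameter \<open>s + t\<close>; infima over \<open>t\<close> and then over
      \<open>s\<close> follow.\<close>
    have step: "q' (u + v) \<le> (q (u + s *\<^sub>R y) - s * q y) + (q (v + t *\<^sub>R y) - t * q y)"
      if "s \<ge> 0" "t \<ge> 0" for s t
      using le[of "s + t" "u + v"] sublinear_add[OF q, of "u + s *\<^sub>R y" "v + t *\<^sub>R y"] that
      by (simp add: algebra_simps)
    have "q' (u + v) - (q (u + s *\<^sub>R y) - s * q y) \<le> q' v" if "s \<ge> 0" for s
    proof (rule ge)
      fix t :: real assume "t \<ge> 0"
      then show "q' (u + v) - (q (u + s *\<^sub>R y) - s * q y) \<le> q (v + t *\<^sub>R y) - t * q y"
        using step[OF that] by force
    qed
    then have "q' (u + v) - q' v \<le> q' u"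
      by (intro ge) (force simp: algebra_simps)
    then show ?thesis by simp
  qed
  have hom: "q' (c *\<^sub>R x) \<le> c * q' x" if c: "c > 0" for c x
  proof -
    have "q' (c *\<^sub>R x) / c \<le> q' x"
    proof (rule ge)
      fix t :: real assume "t \<ge> 0"
      then have "q' (c *\<^sub>R x) \<le> q (c *\<^sub>R (x + t *\<^sub>R y)) - (c * t) * q y"
        using le[of "c * t" "c *\<^sub>R x"] c by (simp add: algebra_simps)
      also have "\<dots> = c * (q (x + t *\<^sub>R y) - t * q y)"
        using sublinear_scaleR[OF q c, of "x + t *\<^sub>R y"] by (simp add: right_diff_distrib)
      finally show "q' (c *\<^sub>R x) / c \<le> q (x + t *\<^sub>R y) - t * q y"
        using c by (simp add: field_simps)
    qed
    then show ?thesis using c by (simp add: field_simps)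
  qed
  have "sublinear q'" using add hom by (simp add: sublinear_def)
  \<comment> \<open>The parameters \<open>t = 0\<close> and \<open>t = 1\<close> in the infimum give
    the two required bounds.\<close>
  moreover have "q' \<le> q" using le[of 0] by (simp add: le_fun_def)
  moreover have "\<forall>x. q' x \<le> q (x + y) - q y" using le[of 1] by simp
  ultimately show ?thesis by blast
qed

text \<open>By minimality the functional from \<open>sublinear_decrease\<close> is \<open>q\<close>
  itself, and its defining bound then reads as superadditivity. Additivity makes \<open>q\<close>
  odd, which settles negative scalars.\<close>

lemma minimal_sublinear_linear:
  assumes q: "sublinear q" and min: "\<And>g. sublinear g \<Longrightarrow> g \<le> q \<Longrightarrow> g = q"
  shows "linear q"
proof -
  have add: "q (x + y) = q x + q y" for x y
  proof (rule antisym)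
    obtain q' where "sublinear q'" "q' \<le> q" "\<And>x. q' x \<le> q (x + y) - q y"
      using sublinear_decrease[OF q] by blast
    then have "q x \<le> q (x + y) - q y" using min by metis
    then show "q x + q y \<le> q (x + y)" by simp
  qed (rule sublinear_add[OF q])
  have minus: "q (- x) = - q x" for x
    using add[of x "- x"] sublinear_zero[OF q] by simp
  have "q (c *\<^sub>R x) = c * q x" for c x
  proof -
    consider "c > 0" | "c = 0" | "- c > 0" by linarith
    then show ?thesis
    proof cases
      case 3
      then show ?thesis
        using sublinear_scaleR[OF q 3, of x] minus[of "c *\<^sub>R x"] by simp
    qed (use sublinear_scaleR[OF q] sublinear_zero[OF q] in auto)
  qed
  then show ?thesis using add by (intro linearI) auto
qed

text \<open>Zorn's lemma gives a minimal sublinear functional below \<open>p\<close>, and minimal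
  ones are linear. The order is reversed because Zorn's lemma is stated for maximal
  elements.\<close>

lemma linear_below_sublinear:
  assumes p: "sublinear p"
  shows "\<exists>f. linear f \<and> f \<le> p"
proof -
  let ?A = "{g. sublinear g \<and> g \<le> p}"
  have "\<exists>m\<in>?A. \<forall>a\<in>?A. m \<ge> a \<longrightarrow> a = m"
  proof (rule predicate_Zorn)
    show "partial_order_on ?A (relation_of (\<ge>) ?A)"
      by (rule partial_order_on_relation_ofI) auto
    fix C assume C: "C \<in> Chains (relation_of (\<ge>) ?A)"
    then have sub: "sublinear g \<and> g \<le> p" if "g \<in> C" for g
      using that by (auto simp: Chains_def relation_of_def)
    have chain: "g \<le> h \<or> h \<le> g" if "g \<in> C" "h \<in> C" for g h
      using that C by (auto simp: Chains_def relation_of_def)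
    show "\<exists>u\<in>?A. \<forall>a\<in>C. a \<ge> u"
    proof (cases "C = {}")
      case True
      then show ?thesis using p by auto
    next
      case False
      from sublinear_INF_chain[OF this sub chain]
      have m: "sublinear (\<lambda>x. INF g\<in>C. g x)" "\<forall>g\<in>C. (\<lambda>x. INF g\<in>C. g x) \<le> g" by auto
      moreover obtain g where "g \<in> C" using False by blast
      ultimately have "(\<lambda>x. INF g\<in>C. g x) \<le> p" using sub by (meson order_trans)
      with m show ?thesis by blast
    qed
  qed
  then obtain m where m: "sublinear m" "m \<le> p"
    and min: "\<And>a. sublinear a \<Longrightarrow> a \<le> p \<Longrightarrow> a \<le> m \<Longrightarrow> a = m" by auto
  have "linear m"
    using m min by (intro minimal_sublinear_linear) (auto intro: order_trans)
  with m show ?thesis by blast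
qed

text \<open>Lowering the norm in the direction \<open>z\<close> before taking a linear minorant
  \<open>f\<close> forces \<open>f (- z) \<le> - norm z\<close>. Together with
  \<open>f \<le> norm\<close> this gives the value \<open>norm z\<close> at \<open>z\<close>,
  without extending a functional from the line through \<open>z\<close>.\<close>

lemma norming_functionals_nonempty:
  fixes z :: "'a::real_normed_vector"
  assumes "z \<noteq> 0"
  shows "norming_functionals z \<noteq> {}"
proof -
  obtain q where q: "sublinear q" "q \<le> norm" "\<And>x. q x \<le> norm (x + z) - norm z"
    using sublinear_decrease[OF sublinear_norm, of z] by blast
  obtain f where f: "linear f" "f \<le> q"
    using linear_below_sublinear[OF q(1)] by blast
  have le: "f x \<le> norm x" for x
    using f(2) q(2) by (meson le_funD order_trans)
  have abs: "\<bar>f x\<bar> \<le> norm x" for x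
    using le[of x] le[of "- x"] linear_neg[OF f(1), of x] by auto
  have "bounded_linear f"
    using f(1) abs by (intro bounded_linear_intro[where K = 1]) (auto simp: linear_add linear_scale)
  then obtain g :: "'a \<Rightarrow>\<^sub>L real" where g: "blinfun_apply g = f"
    using bounded_linear_Blinfun_apply by blast
  have "f (- z) \<le> - norm z"
    using le_funD[OF f(2), of "- z"] q(3)[of "- z"] by simp
  then have gz: "g z = norm z"
    using le[of z] linear_neg[OF f(1), of z] g by simp
  have "norm g \<le> 1"
    using abs g by (intro norm_blinfun_bound) auto
  moreover have "1 \<le> norm g"
    using norm_blinfun[of g z] gz assms by simp
  ultimately show ?thesis
    using gz by (auto simp: norming_functionals_def)
qed

lemma functionals_separate_zero:
  fixes z :: "'a::real_normed_vector"
  assumes "\<And>f :: 'a \<Rightarrow>\<^sub>L real. f z = 0"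
  shows "z = 0"
proof (rule ccontr)
  assume "z \<noteq> 0"
  then obtain f where "f \<in> norming_functionals z"
    using norming_functionals_nonempty by blast
  with assms[of f] \<open>z \<noteq> 0\<close> show False
    by (simp add: norming_functionals_def)
qed

section \<open>Weak limits along filters\<close>

definition weak_tendsto :: "('i \<Rightarrow> 'a::real_normed_vector) \<Rightarrow> 'a \<Rightarrow> 'i filter \<Rightarrow> bool" where
  "weak_tendsto x l F \<longleftrightarrow> (\<forall>f :: 'a \<Rightarrow>\<^sub>L real. ((\<lambda>n. f (x n)) \<longlongrightarrow> f l) F)"

lemma weakly_converges_to_iff: "weakly_converges_to x l \<longleftrightarrow> weak_tendsto x l sequentially"
  by (simp add: weakly_converges_to_def weak_tendsto_def)

lemma weak_tendsto_mono: "weak_tendsto x l F \<Longrightarrow> F' \<le> F \<Longrightarrow> weak_tendsto x l F'"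
  unfolding weak_tendsto_def by (auto elim: tendsto_mono[rotated])

lemma weak_tendsto_eventually_cong:
  fixes x y :: "'i \<Rightarrow> 'a::real_normed_vector"
  assumes "weak_tendsto x l F" "\<forall>\<^sub>F n in F. x n = y n"
  shows "weak_tendsto y l F"
  unfolding weak_tendsto_def
proof
  fix f :: "'a \<Rightarrow>\<^sub>L real"
  have "\<forall>\<^sub>F n in F. blinfun_apply f (x n) = f (y n)"
    using assms(2) by eventually_elim simp
  moreover have "((\<lambda>n. blinfun_apply f (x n)) \<longlongrightarrow> f l) F"
    using assms(1) by (simp add: weak_tendsto_def)
  ultimately show "((\<lambda>n. blinfun_apply f (y n)) \<longlongrightarrow> f l) F"
    by (rule Lim_transform_eventually[rotated])
qed

lemma weak_tendsto_add:
  "weak_tendsto x l F \<Longrightarrow> weak_tendsto y m F \<Longrightarrow> weak_tendsto (\<lambda>n. x n + y n) (l + m) F"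
  unfolding weak_tendsto_def by (auto simp: blinfun.add_right intro: tendsto_add)

lemma weak_tendsto_diff:
  "weak_tendsto x l F \<Longrightarrow> weak_tendsto y m F \<Longrightarrow> weak_tendsto (\<lambda>n. x n - y n) (l - m) F"
  unfolding weak_tendsto_def by (auto simp: blinfun.diff_right intro: tendsto_diff)

lemma weak_tendsto_blinfun_apply:
  fixes T :: "'a::real_normed_vector \<Rightarrow>\<^sub>L 'b::real_normed_vector"
  assumes "weak_tendsto x l F"
  shows "weak_tendsto (\<lambda>n. T (x n)) (T l) F"
  unfolding weak_tendsto_def
proof
  fix f :: "'b \<Rightarrow>\<^sub>L real"
  show "((\<lambda>n. f (T (x n))) \<longlongrightarrow> f (T l)) F"
    using assms[unfolded weak_tendsto_def, rule_format, of "f o\<^sub>L T"] by simp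
qed

lemma weak_tendsto_unique:
  fixes l m :: "'a::real_normed_vector"
  assumes "weak_tendsto x l F" "weak_tendsto x m F" "F \<noteq> bot"
  shows "l = m"
proof -
  have "f (l - m) = 0" for f :: "'a \<Rightarrow>\<^sub>L real"
    using assms tendsto_unique[of F "\<lambda>n. f (x n)" "f l" "f m"]
    by (simp add: weak_tendsto_def blinfun.diff_right)
  then show ?thesis using functionals_separate_zero[of "l - m"] by simp
qed

text \<open>Compactness gives a cluster point \<open>l\<close> of the image filter. Intersecting
  \<open>F\<close> with the preimages of the neighbourhoods of \<open>l\<close> forces convergence,
  and the result is proper because otherwise some neighbourhood of \<open>l\<close> would eventually
  be avoided.\<close>

lemma compact_subfilter_tendsto:
  assumes "compact K" "F \<noteq> bot" "eventually (\<lambda>n. a n \<in> K) F"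
  obtains l F' where "l \<in> K" "F' \<le> F" "F' \<noteq> bot" "(a \<longlongrightarrow> l) F'"
proof -
  obtain l where l: "l \<in> K" "inf (nhds l) (filtermap a F) \<noteq> bot"
    using assms(1)[unfolded compact_filter, rule_format, of "filtermap a F"] assms(2,3)
    by (auto simp: eventually_filtermap filtermap_bot_iff)
  let ?F = "inf F (filtercomap a (nhds l))"
  have "?F \<noteq> bot"
  proof
    assume "?F = bot"
    then obtain P R where "eventually P F" "eventually R (filtercomap a (nhds l))"
      "\<And>n. P n \<Longrightarrow> \<not> R n"
      unfolding trivial_limit_def eventually_inf by auto
    moreover from this(2) obtain Q where "eventually Q (nhds l)" "\<And>n. Q (a n) \<Longrightarrow> R n"
      unfolding eventually_filtercomap by auto
    ultimately have "eventually (\<lambda>x. \<not> Q x) (filtermap a F)"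
      unfolding eventually_filtermap by (meson eventually_mono)
    then have "eventually (\<lambda>x. False) (inf (nhds l) (filtermap a F))"
      using \<open>eventually Q (nhds l)\<close> unfolding eventually_inf by blast
    then show False using l(2) by (simp add: trivial_limit_def)
  qed
  moreover have "(a \<longlongrightarrow> l) ?F"
    by (simp add: filterlim_iff_le_filtercomap)
  ultimately show ?thesis using l(1) that by (meson inf_le1)
qed

section \<open>Weak compactness of bounded families in a reflexive space\<close>

lemma compact_PiE_UNIV:
  fixes B :: "'i \<Rightarrow> 'b::topological_space set"
  assumes "\<And>i. compact (B i)"
  shows "compact (PiE UNIV B)"
  using assms compactin_PiE[of "\<lambda>_. euclidean" UNIV B]
  by (simp add: euclidean_product_topology)

text \<open>The pointwise limit of the evaluations at \<open>x n\<close> is linear and bounded by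
  \<open>M\<close> on the dual, so reflexivity represents it by a vector. It serves both limits
  obtained from compactness and limits of weakly Cauchy orbits.\<close>

lemma reflexive_space_limit_functional:
  fixes x :: "'i \<Rightarrow> 'a::real_normed_vector" and \<phi> :: "('a \<Rightarrow>\<^sub>L real) \<Rightarrow> real"
  assumes refl: "reflexive_space TYPE('a)" and "F \<noteq> bot"
    and bound: "\<And>n. norm (x n) \<le> M"
    and lim: "\<And>f. ((\<lambda>n. blinfun_apply f (x n)) \<longlongrightarrow> \<phi> f) F"
  obtains l where "weak_tendsto x l F"
proof -
  have "bounded_linear \<phi>"
  proof (rule bounded_linear_intro[where K = M])
    fix f g :: "'a \<Rightarrow>\<^sub>L real" and c :: real
    show "\<phi> (f + g) = \<phi> f + \<phi> g"
      using tendsto_unique[OF \<open>F \<noteq> bot\<close> lim[of "f + g"]] tendsto_add[OF lim[of f] lim[of g]]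
      by (simp add: blinfun.add_left)
    show "\<phi> (c *\<^sub>R f) = c *\<^sub>R \<phi> f"
      using tendsto_unique[OF \<open>F \<noteq> bot\<close> lim[of "c *\<^sub>R f"]] tendsto_scaleR[OF tendsto_const lim[of f]]
      by (simp add: blinfun.scaleR_left)
    have "norm (f (x n)) \<le> norm f * M" for n
      using norm_blinfun[of f "x n"] bound[of n] by (meson mult_left_mono norm_ge_zero order_trans)
    then show "norm (\<phi> f) \<le> norm f * M"
      using tendsto_upperbound[OF tendsto_norm[OF lim[of f]] _ \<open>F \<noteq> bot\<close>] by simp
  qed
  then obtain \<psi> :: "('a \<Rightarrow>\<^sub>L real) \<Rightarrow>\<^sub>L real" where "blinfun_apply \<psi> = \<phi>"
    using bounded_linear_Blinfun_apply by blast
  then obtain l where "\<And>f. \<phi> f = blinfun_apply f l"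
    using refl unfolding reflexive_space_def by metis
  then show ?thesis using lim that[of l] by (simp add: weak_tendsto_def)
qed

text \<open>The Banach-Alaoglu argument in the bidual: evaluation at \<open>x n\<close> is a point
  of a product of compact intervals, and convergence in that product is convergence on each
  functional.\<close>

lemma reflexive_space_weak_subfilter:
  fixes x :: "'i \<Rightarrow> 'a::real_normed_vector"
  assumes refl: "reflexive_space TYPE('a)" and "F \<noteq> bot"
    and bound: "\<And>n. norm (x n) \<le> M"
  obtains l F' where "F' \<le> F" "F' \<noteq> bot" "weak_tendsto x l F'"
proof -
  let ?a = "\<lambda>n (f :: 'a \<Rightarrow>\<^sub>L real). f (x n)"
  let ?K = "PiE UNIV (\<lambda>f :: 'a \<Rightarrow>\<^sub>L real. {- (norm f * M) .. norm f * M})"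
  have abs: "\<bar>f (x n)\<bar> \<le> norm f * M" for n and f :: "'a \<Rightarrow>\<^sub>L real"
    using norm_blinfun[of f "x n"] bound[of n]
    by (metis mult_left_mono norm_ge_zero order_trans real_norm_def)
  have "f (x n) \<in> {- (norm f * M) .. norm f * M}" for n and f :: "'a \<Rightarrow>\<^sub>L real"
    using abs[of f n] by (simp add: abs_le_iff minus_le_iff[of "f (x n)"])
  then have "?a n \<in> ?K" for n by (intro PiE_I) auto
  moreover have "compact ?K" by (intro compact_PiE_UNIV) simp
  ultimately obtain \<phi> F' where F': "F' \<le> F" "F' \<noteq> bot" "(?a \<longlongrightarrow> \<phi>) F'"
    using \<open>F \<noteq> bot\<close> by (elim compact_subfilter_tendsto[of ?K F ?a]) auto
  have "((\<lambda>n. blinfun_apply f (x n)) \<longlongrightarrow> \<phi> f) F'" for f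
    using continuous_on_tendsto_compose[OF continuous_on_product_coordinates F'(3), of f]
    by simp
  from reflexive_space_limit_functional[OF refl F'(2) bound this] show ?thesis
    using F' that by blast
qed

section \<open>Contractions\<close>

lemma contraction_blinfun_compose: "contraction A \<Longrightarrow> contraction B \<Longrightarrow> contraction (A o\<^sub>L B)"
  unfolding contraction_def by (auto intro: order_trans)

lemma contraction_generated_semigroup:
  assumes "W \<in> generated_semigroup G" "\<And>T. T \<in> G \<Longrightarrow> contraction T"
  shows "contraction W"
  using assms(1) by induction (auto simp: assms(2) contraction_blinfun_compose)

lemma generated_semigroup_fixed_point:
  assumes "W \<in> generated_semigroup G" "\<And>T. T \<in> G \<Longrightarrow> blinfun_apply T z = z"
  shows "blinfun_apply W z = z"
  using assms(1) by induction (auto simp: assms(2))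

text \<open>With \<open>z = l - m\<close>, composition with \<open>W n\<close> maps the norming functionals of \<open>z\<close> into
  themselves. By compactness every norming functional \<open>f\<close> then has a companion \<open>g\<close>, again norming,
  with \<open>f m = g l = g m + norm z\<close>, which is absurd when \<open>f\<close> minimizes \<open>f m\<close>.\<close>

lemma weak_limits_eq:
  fixes x :: "'i \<Rightarrow> 'a::real_normed_vector" and W :: "'i \<Rightarrow> 'a \<Rightarrow>\<^sub>L 'a"
  assumes "F \<noteq> bot"
    and bound: "\<And>n. norm (x n) \<le> M"
    and con: "\<And>n. contraction (W n)"
    and fix_z: "\<And>n. W n (l - m) = l - m"
    and l: "weak_tendsto x l F"
    and m: "weak_tendsto (\<lambda>n. W n (x n)) m F"
    and comp: "l - m \<noteq> 0 \<Longrightarrow> compact (norming_functionals (l - m))"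
  shows "l = m"
proof (rule ccontr)
  assume "l \<noteq> m"
  define z where "z = l - m"
  let ?K = "norming_functionals z"
  have "z \<noteq> 0" using \<open>l \<noteq> m\<close> by (simp add: z_def)
  then have K: "compact ?K" "?K \<noteq> {}"
    using comp norming_functionals_nonempty[of z] by (auto simp: z_def)
  have diff: "f l = f m + norm z" if "f \<in> ?K" for f
    using that by (simp add: norming_functionals_def z_def blinfun.diff_right)
  have "continuous_on ?K (\<lambda>f. blinfun_apply f m)"
    by (intro continuous_intros)
  then obtain f where f: "f \<in> ?K" "\<And>g. g \<in> ?K \<Longrightarrow> f m \<le> blinfun_apply g m"
    using continuous_attains_inf[OF K] by blast
  \<comment> \<open>The norm cannot exceed one since \<open>W n\<close> is a contraction, and cannot
    drop below one since \<open>W n\<close> fixes \<open>z\<close>, where \<open>f\<close> attains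
    its norm.\<close>
  have invariant: "f o\<^sub>L W n \<in> ?K" for n
  proof -
    have nf: "norm f = 1" "f z = norm z"
      using f(1) by (auto simp: norming_functionals_def)
    have val: "(f o\<^sub>L W n) z = norm z"
      using fix_z[of n] nf(2) by (simp add: z_def)
    have "norm ((f o\<^sub>L W n) u) \<le> 1 * norm u" for u
      using norm_blinfun[of f "W n u"] con[of n] nf(1)
      by (simp add: contraction_def) (meson order_trans)
    then have "norm (f o\<^sub>L W n) \<le> 1"
      by (intro norm_blinfun_bound) auto
    moreover have "1 \<le> norm (f o\<^sub>L W n)"
      using norm_blinfun[of "f o\<^sub>L W n" z] val \<open>z \<noteq> 0\<close> by simp
    ultimately show ?thesis using val by (simp add: norming_functionals_def)
  qed
  obtain g F' where g: "g \<in> ?K" "F' \<le> F" "F' \<noteq> bot" "((\<lambda>n. f o\<^sub>L W n) \<longlongrightarrow> g) F'"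
    using compact_subfilter_tendsto[OF K(1) \<open>F \<noteq> bot\<close>, of "\<lambda>n. f o\<^sub>L W n"] invariant
    by auto
  \<comment> \<open>Convergence of \<open>f o\<^sub>L W n\<close> to \<open>g\<close> in norm is
    uniform on the ball of radius \<open>M\<close>, so the moving vectors \<open>x n\<close> can be
    inserted.\<close>
  have "((\<lambda>n. f (W n (x n)) - g (x n)) \<longlongrightarrow> 0) F'"
  proof (rule Lim_null_comparison)
    show "\<forall>\<^sub>F n in F'. norm (f (W n (x n)) - g (x n)) \<le> norm ((f o\<^sub>L W n) - g) * M"
    proof (rule always_eventually, rule allI)
      fix n
      have "norm (f (W n (x n)) - g (x n)) \<le> norm ((f o\<^sub>L W n) - g) * norm (x n)"
        using norm_blinfun[of "(f o\<^sub>L W n) - g" "x n"] by (simp add: blinfun.diff_left)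
      also have "\<dots> \<le> norm ((f o\<^sub>L W n) - g) * M"
        using bound by (intro mult_left_mono) auto
      finally show "norm (f (W n (x n)) - g (x n)) \<le> norm ((f o\<^sub>L W n) - g) * M" .
    qed
    show "((\<lambda>n. norm ((f o\<^sub>L W n) - g) * M) \<longlongrightarrow> 0) F'"
      using g(4) by (intro tendsto_mult_left_zero tendsto_norm_zero) (simp add: LIM_zero)
  qed
  moreover have "((\<lambda>n. f (W n (x n)) - g (x n)) \<longlongrightarrow> f m - g l) F'"
    using weak_tendsto_mono[OF l g(2)] weak_tendsto_mono[OF m g(2)]
    unfolding weak_tendsto_def by (intro tendsto_diff) auto
  ultimately have "f m = g l"
    using tendsto_unique[OF g(3)] by fastforce
  then show False
    using diff[OF g(1)] f(2)[OF g(1)] \<open>z \<noteq> 0\<close> by simp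
qed

section \<open>Property (W)\<close>

text \<open>Lets the results about \<open>property_W\<close> be applied to a single generator as
  well as to a semigroup.\<close>

lemma W_contraction_iff: "W_contraction T \<longleftrightarrow> contraction T \<and> property_W {T}"
proof -
  have "property_W {T} \<longleftrightarrow>
     (\<forall>x. bounded (range x) \<longrightarrow> (\<lambda>n. norm (x n) - norm (T (x n))) \<longlonglongrightarrow> 0 \<longrightarrow>
        weakly_converges_to (\<lambda>n. x n - T (x n)) 0)"
    unfolding property_W_def by (auto dest: spec[where x = "\<lambda>_. T"] simp: singleton_iff)
  then show ?thesis by (simp add: W_contraction_def)
qed

text \<open>If no \<open>\<delta>\<close> worked, counterexamples for
  \<open>\<delta> = 1 / (k + 1)\<close> would form a bounded sequence violating (W). The
  \<open>\<epsilon>\<close>-\<open>\<delta>\<close> form carries (W) from sequences over to filters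
  and to Cauchy conditions.\<close>

lemma property_W_uniform:
  fixes f :: "'a::real_normed_vector \<Rightarrow>\<^sub>L real"
  assumes W: "property_W \<S>" and "\<epsilon> > 0"
  obtains \<delta> where "\<delta> > 0"
    "\<And>x A. A \<in> \<S> \<Longrightarrow> norm x \<le> M \<Longrightarrow> \<bar>norm x - norm (blinfun_apply A x)\<bar> < \<delta> \<Longrightarrow>
      \<bar>blinfun_apply f (x - blinfun_apply A x)\<bar> < \<epsilon>"
proof -
  have "\<exists>\<delta>>0. \<forall>x. \<forall>A\<in>\<S>. norm x \<le> M \<longrightarrow> \<bar>norm x - norm (blinfun_apply A x)\<bar> < \<delta> \<longrightarrow>
      \<bar>blinfun_apply f (x - blinfun_apply A x)\<bar> < \<epsilon>"
  proof (rule ccontr)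
    assume "\<not> ?thesis"
    then have "\<exists>x. \<exists>A\<in>\<S>. norm x \<le> M \<and> \<bar>norm x - norm (blinfun_apply A x)\<bar> < \<delta> \<and>
      \<not> \<bar>blinfun_apply f (x - blinfun_apply A x)\<bar> < \<epsilon>" if "\<delta> > 0" for \<delta>
      using that by blast
    then have "\<forall>k. \<exists>x. \<exists>A\<in>\<S>. norm x \<le> M \<and>
      \<bar>norm x - norm (blinfun_apply A x)\<bar> < inverse (real (Suc k)) \<and>
      \<not> \<bar>blinfun_apply f (x - blinfun_apply A x)\<bar> < \<epsilon>" by simp
    then obtain x A where xA: "\<And>k. A k \<in> \<S>" "\<And>k. norm (x k) \<le> M"
      "\<And>k. \<bar>norm (x k) - norm (blinfun_apply (A k) (x k))\<bar> < inverse (real (Suc k))"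
      "\<And>k. \<not> \<bar>blinfun_apply f (x k - blinfun_apply (A k) (x k))\<bar> < \<epsilon>" by metis
    have "(\<lambda>k. norm (x k) - norm (A k (x k))) \<longlonglongrightarrow> 0"
      by (rule Lim_null_comparison[OF _ LIMSEQ_inverse_real_of_nat])
        (use xA(3) in \<open>auto intro!: always_eventually less_imp_le\<close>)
    moreover have "bounded (range x)"
      using xA(2) by (auto simp: bounded_iff)
    ultimately have "weakly_converges_to (\<lambda>k. x k - A k (x k)) 0"
      using W xA(1) unfolding property_W_def by blast
    then have "(\<lambda>k. f (x k - A k (x k))) \<longlonglongrightarrow> 0"
      unfolding weakly_converges_to_def by fastforce
    then have "\<forall>\<^sub>F k in sequentially. \<bar>f (x k - A k (x k))\<bar> < \<epsilon>"
      using \<open>\<epsilon> > 0\<close> unfolding tendsto_iff by (simp add: dist_real_def)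
    then show False using xA(4) by simp
  qed
  then show ?thesis using that by blast
qed

lemma property_W_filter:
  fixes x :: "'i \<Rightarrow> 'a::real_normed_vector" and A :: "'i \<Rightarrow> 'a \<Rightarrow>\<^sub>L 'a"
  assumes W: "property_W \<S>"
    and bound: "\<And>n. norm (x n) \<le> M"
    and A: "\<forall>\<^sub>F n in F. A n \<in> insert id_blinfun \<S>"
    and lim: "((\<lambda>n. norm (x n) - norm (A n (x n))) \<longlongrightarrow> 0) F"
  shows "weak_tendsto (\<lambda>n. x n - A n (x n)) 0 F"
  unfolding weak_tendsto_def
proof
  fix f :: "'a \<Rightarrow>\<^sub>L real"
  have "((\<lambda>n. f (x n - A n (x n))) \<longlongrightarrow> 0) F"
  proof (rule tendstoI)
    fix \<epsilon> :: real assume "\<epsilon> > 0"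
    then obtain \<delta> where \<delta>: "\<delta> > 0"
      "\<And>x A. A \<in> \<S> \<Longrightarrow> norm x \<le> M \<Longrightarrow> \<bar>norm x - norm (blinfun_apply A x)\<bar> < \<delta> \<Longrightarrow>
        \<bar>blinfun_apply f (x - blinfun_apply A x)\<bar> < \<epsilon>"
      using property_W_uniform[OF W, of \<epsilon> M f] by metis
    have "\<forall>\<^sub>F n in F. \<bar>norm (x n) - norm (A n (x n))\<bar> < \<delta>"
      using lim \<delta>(1) unfolding tendsto_iff by (simp add: dist_real_def)
    with A show "\<forall>\<^sub>F n in F. dist (f (x n - A n (x n))) 0 < \<epsilon>"
    proof eventually_elim
      case (elim n)
      then show ?case
        using \<delta>(2)[of "A n" "x n"] bound[of n] \<open>\<epsilon> > 0\<close> by (auto simp: dist_real_def)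
    qed
  qed
  then show "((\<lambda>n. f (x n - A n (x n))) \<longlongrightarrow> f 0) F" by simp
qed

section \<open>Cutting words at a generator\<close>

lemma generated_semigroup_compose_id:
  assumes "A \<in> generated_semigroup G" "U \<in> insert id_blinfun (generated_semigroup G)"
  shows "A o\<^sub>L U \<in> generated_semigroup G" "U o\<^sub>L A \<in> generated_semigroup G"
proof -
  have "A o\<^sub>L id_blinfun = A" "id_blinfun o\<^sub>L A = A" by (auto intro: blinfun_eqI)
  then show "A o\<^sub>L U \<in> generated_semigroup G" "U o\<^sub>L A \<in> generated_semigroup G"
    using assms by (auto intro: generated_semigroup.compose)
qed

text \<open>Factors act from right to left, so \<open>V\<close> collects what is applied before
  \<open>T\<close> acts for the first time. The identity stands for an empty piece.\<close>

lemma generated_semigroup_first_occurrence: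
  assumes "W \<in> generated_semigroup G"
  shows "W \<in> generated_semigroup (G - {T}) \<or>
    (\<exists>U \<in> insert id_blinfun (generated_semigroup G).
     \<exists>V \<in> insert id_blinfun (generated_semigroup (G - {T})).
       \<forall>x. blinfun_apply W x = blinfun_apply U (blinfun_apply T (blinfun_apply V x)))"
  using assms
proof induction
  case (generator A)
  show ?case
  proof (cases "A = T")
    case True
    then show ?thesis by (intro disjI2 bexI[of _ id_blinfun]) auto
  next
    case False
    then show ?thesis using generator by (auto intro: generated_semigroup.generator)
  qed
next
  case (compose A B)
  \<comment> \<open>\<open>B\<close> acts first, so \<open>T\<close> is sought in \<open>B\<close>,
    and in \<open>A\<close> only if \<open>B\<close> avoids it.\<close>
  from compose.IH(2) show ?case
  proof
    assume B: "B \<in> generated_semigroup (G - {T})"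
    from compose.IH(1) show ?thesis
    proof
      assume "A \<in> generated_semigroup (G - {T})"
      then show ?thesis using B by (auto intro: generated_semigroup.compose)
    next
      assume "\<exists>U \<in> insert id_blinfun (generated_semigroup G).
        \<exists>V \<in> insert id_blinfun (generated_semigroup (G - {T})).
          \<forall>x. A x = blinfun_apply U (T (blinfun_apply V x))"
      then obtain U V where "U \<in> insert id_blinfun (generated_semigroup G)"
        "V \<in> insert id_blinfun (generated_semigroup (G - {T}))" "\<And>x. A x = U (T (V x))" by blast
      moreover from this(2) have "V o\<^sub>L B \<in> insert id_blinfun (generated_semigroup (G - {T}))"
        using generated_semigroup_compose_id(2)[OF B] by blast
      ultimately show ?thesis
        by (intro disjI2 bexI[of _ U] bexI[of _ "V o\<^sub>L B"]) auto
    qed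
  next
    assume "\<exists>U \<in> insert id_blinfun (generated_semigroup G).
      \<exists>V \<in> insert id_blinfun (generated_semigroup (G - {T})).
        \<forall>x. B x = blinfun_apply U (T (blinfun_apply V x))"
    then obtain U V where "U \<in> insert id_blinfun (generated_semigroup G)"
      "V \<in> insert id_blinfun (generated_semigroup (G - {T}))" "\<And>x. B x = U (T (V x))" by blast
    moreover from this(1) have "A o\<^sub>L U \<in> insert id_blinfun (generated_semigroup G)"
      using generated_semigroup_compose_id(1)[OF compose.hyps(1)] by blast
    ultimately show ?thesis
      by (intro disjI2 bexI[of _ "A o\<^sub>L U"] bexI[of _ V]) auto
  qed
qed

text \<open>The mirror image: here \<open>V\<close> is the piece applied after the last
  \<open>T\<close>, so in a product the left factor is searched first.\<close>

lemma generated_semigroup_last_occurrence: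
  assumes "W \<in> generated_semigroup G"
  shows "W \<in> generated_semigroup (G - {T}) \<or>
    (\<exists>U \<in> insert id_blinfun (generated_semigroup G).
     \<exists>V \<in> insert id_blinfun (generated_semigroup (G - {T})).
       \<forall>x. blinfun_apply W x = blinfun_apply V (blinfun_apply T (blinfun_apply U x)))"
  using assms
proof induction
  case (generator A)
  show ?case
  proof (cases "A = T")
    case True
    then show ?thesis by (intro disjI2 bexI[of _ id_blinfun]) auto
  next
    case False
    then show ?thesis using generator by (auto intro: generated_semigroup.generator)
  qed
next
  case (compose A B)
  from compose.IH(1) show ?case
  proof
    assume A: "A \<in> generated_semigroup (G - {T})"
    from compose.IH(2) show ?thesis
    proof
      assume "B \<in> generated_semigroup (G - {T})"
      then show ?thesis using A by (auto intro: generated_semigroup.compose)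
    next
      assume "\<exists>U \<in> insert id_blinfun (generated_semigroup G).
        \<exists>V \<in> insert id_blinfun (generated_semigroup (G - {T})).
          \<forall>x. B x = blinfun_apply V (T (blinfun_apply U x))"
      then obtain U V where "U \<in> insert id_blinfun (generated_semigroup G)"
        "V \<in> insert id_blinfun (generated_semigroup (G - {T}))" "\<And>x. B x = V (T (U x))" by blast
      moreover from this(2) have "A o\<^sub>L V \<in> insert id_blinfun (generated_semigroup (G - {T}))"
        using generated_semigroup_compose_id(1)[OF A] by blast
      ultimately show ?thesis
        by (intro disjI2 bexI[of _ U] bexI[of _ "A o\<^sub>L V"]) auto
    qed
  next
    assume "\<exists>U \<in> insert id_blinfun (generated_semigroup G).
      \<exists>V \<in> insert id_blinfun (generated_semigroup (G - {T})).
        \<forall>x. A x = blinfun_apply V (T (blinfun_apply U x))"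
    then obtain U V where "U \<in> insert id_blinfun (generated_semigroup G)"
      "V \<in> insert id_blinfun (generated_semigroup (G - {T}))" "\<And>x. A x = V (T (U x))" by blast
    moreover from this(1) have "U o\<^sub>L B \<in> insert id_blinfun (generated_semigroup G)"
      using generated_semigroup_compose_id(2)[OF compose.hyps(2)] by blast
    ultimately show ?thesis
      by (intro disjI2 bexI[of _ "U o\<^sub>L B"] bexI[of _ V]) auto
  qed
qed

section \<open>Asymptotically fixed sequences and their weak limits\<close>

lemma contraction_insert_id_generated_semigroup:
  assumes "W \<in> insert id_blinfun (generated_semigroup G)" "\<And>T. T \<in> G \<Longrightarrow> contraction T"
  shows "norm (blinfun_apply W x) \<le> norm x"
  using assms contraction_generated_semigroup[of W G] by (auto simp: contraction_def)

text \<open>Norms can only decrease as the pieces of a cut word act in turn, so each piece loses at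
  most the total loss, which tends to \<open>0\<close>. Hence (W) applies separately to
  \<open>T\<close> and to the piece avoiding \<open>T\<close>.\<close>

lemma weak_tendsto_asymptotically_fixed:
  fixes x :: "'i \<Rightarrow> 'a::real_normed_vector" and W :: "'i \<Rightarrow> 'a \<Rightarrow>\<^sub>L 'a"
  assumes "T \<in> G" and G: "\<And>T. T \<in> G \<Longrightarrow> W_contraction T"
    and rest: "property_W (generated_semigroup (G - {T}))"
    and bound: "\<And>n. norm (x n) \<le> M"
    and W: "\<And>n. W n \<in> generated_semigroup G"
    and occ: "\<forall>\<^sub>F n in F. W n \<notin> generated_semigroup (G - {T})"
    and lim: "((\<lambda>n. norm (x n) - norm (W n (x n))) \<longlongrightarrow> 0) F"
  shows "weak_tendsto (\<lambda>n. x n - T (x n)) 0 F"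
    and "weak_tendsto (\<lambda>n. W n (x n) - T (W n (x n))) 0 F"
proof -
  have con: "norm (blinfun_apply T y) \<le> norm y" for y
    using G \<open>T \<in> G\<close> by (auto simp: W_contraction_def contraction_def)
  have cG: "contraction T" if "T \<in> G" for T using G[OF that] by (simp add: W_contraction_def)
  have WT: "property_W {T}" using G[OF \<open>T \<in> G\<close>] by (simp add: W_contraction_iff)
  let ?S = "insert id_blinfun (generated_semigroup G)"
  let ?R = "insert id_blinfun (generated_semigroup (G - {T}))"
  have con_S: "norm (blinfun_apply A y) \<le> norm y" if "A \<in> ?S" for A y
    using contraction_insert_id_generated_semigroup[OF that cG] .
  have con_R: "norm (blinfun_apply A y) \<le> norm y" if "A \<in> ?R" for A y
    using contraction_insert_id_generated_semigroup[OF that] cG by simp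
  have squeeze: "((\<lambda>n. norm (u n) - norm (v n)) \<longlongrightarrow> 0) F"
    if "\<forall>\<^sub>F n in F. norm (v n) \<le> norm (u n) \<and> norm (u n) \<le> norm (x n) \<and>
      norm (W n (x n)) \<le> norm (v n)" for u v :: "'i \<Rightarrow> 'a"
  proof (rule tendsto_sandwich[OF _ _ tendsto_const lim])
    show "\<forall>\<^sub>F n in F. 0 \<le> norm (u n) - norm (v n)"
      using that by eventually_elim simp
    show "\<forall>\<^sub>F n in F. norm (u n) - norm (v n) \<le> norm (x n) - norm (W n (x n))"
      using that by eventually_elim simp
  qed

  have "\<forall>n. \<exists>U V. W n \<notin> generated_semigroup (G - {T}) \<longrightarrow>
      U \<in> ?S \<and> V \<in> ?R \<and> (\<forall>x. W n x = blinfun_apply U (T (blinfun_apply V x)))"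
    using generated_semigroup_first_occurrence[OF W] by blast
  then obtain U V where UV: "\<And>n. W n \<notin> generated_semigroup (G - {T}) \<Longrightarrow>
      U n \<in> ?S \<and> V n \<in> ?R \<and> (\<forall>x. W n x = blinfun_apply (U n) (T (blinfun_apply (V n) x)))"
    by metis
  \<comment> \<open>The choice \<open>V n\<close> is unspecified when \<open>W n\<close> avoids
    \<open>T\<close>. The default identity makes \<open>V' n\<close> a contraction for every
    \<open>n\<close>, as the bound by \<open>M\<close> below demands.\<close>
  define V' where "V' n = (if W n \<in> generated_semigroup (G - {T}) then id_blinfun else V n)" for n
  have V': "V' n \<in> ?R" for n using UV by (auto simp: V'_def)
  have ev: "\<forall>\<^sub>F n in F. U n \<in> ?S \<and> W n (x n) = U n (T (V' n (x n)))"
    using occ by eventually_elim (use UV in \<open>auto simp: V'_def\<close>)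
  have "weak_tendsto (\<lambda>n. x n - V' n (x n)) 0 F"
  proof (rule property_W_filter[OF rest bound])
    show "((\<lambda>n. norm (x n) - norm (V' n (x n))) \<longlongrightarrow> 0) F"
      by (rule squeeze, use ev in eventually_elim) (metis V' con con_R con_S order_refl order_trans)
  qed (use V' in \<open>auto intro: always_eventually\<close>)
  moreover have "weak_tendsto (\<lambda>n. V' n (x n) - T (V' n (x n))) 0 F"
  proof (rule property_W_filter[OF WT])
    show "norm (V' n (x n)) \<le> M" for n
      using con_R[OF V'] bound by (meson order_trans)
    show "((\<lambda>n. norm (V' n (x n)) - norm (T (V' n (x n)))) \<longlongrightarrow> 0) F"
      by (rule squeeze, use ev in eventually_elim) (metis V' con con_R con_S order_refl order_trans)
  qed simp
  \<comment> \<open>With \<open>v = V' n (x n)\<close>, the sum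
    \<open>(x n - v) + (v - T v) - T (x n - v)\<close> collapses to
    \<open>x n - T (x n)\<close>.\<close>
  ultimately have "weak_tendsto (\<lambda>n. (x n - V' n (x n)) + (V' n (x n) - T (V' n (x n)))
      - T (x n - V' n (x n))) (0 + 0 - T 0) F"
    by (intro weak_tendsto_diff weak_tendsto_add weak_tendsto_blinfun_apply)
  then show "weak_tendsto (\<lambda>n. x n - T (x n)) 0 F"
    by (simp add: blinfun.diff_right)

  \<comment> \<open>For the images \<open>W n (x n)\<close> the cut is at the last \<open>T\<close>,
    so that the piece avoiding \<open>T\<close> ends the word.\<close>
  have "\<forall>n. \<exists>U V. W n \<notin> generated_semigroup (G - {T}) \<longrightarrow>
      U \<in> ?S \<and> V \<in> ?R \<and> (\<forall>x. W n x = blinfun_apply V (T (blinfun_apply U x)))"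
    using generated_semigroup_last_occurrence[OF W] by blast
  then obtain P Q where PQ: "\<And>n. W n \<notin> generated_semigroup (G - {T}) \<Longrightarrow>
      P n \<in> ?S \<and> Q n \<in> ?R \<and> (\<forall>x. W n x = blinfun_apply (Q n) (T (blinfun_apply (P n) x)))"
    by metis
  define P' where "P' n = (if W n \<in> generated_semigroup (G - {T}) then id_blinfun else P n)" for n
  have P': "P' n \<in> ?S" for n using PQ by (auto simp: P'_def)
  have ev: "\<forall>\<^sub>F n in F. Q n \<in> ?R \<and> W n (x n) = Q n (T (P' n (x n)))"
    using occ by eventually_elim (use PQ in \<open>auto simp: P'_def\<close>)
  have bound': "norm (P' n (x n)) \<le> M" for n
    using con_S[OF P'] bound by (meson order_trans)
  have "weak_tendsto (\<lambda>n. P' n (x n) - T (P' n (x n))) 0 F"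
  proof (rule property_W_filter[OF WT bound'])
    show "((\<lambda>n. norm (P' n (x n)) - norm (T (P' n (x n)))) \<longlongrightarrow> 0) F"
      by (rule squeeze, use ev in eventually_elim) (metis P' con con_R con_S order_refl order_trans)
  qed simp
  moreover have "weak_tendsto (\<lambda>n. T (P' n (x n)) - Q n (T (P' n (x n)))) 0 F"
  proof (rule property_W_filter[OF rest])
    show "norm (T (P' n (x n))) \<le> M" for n
      using con bound' by (meson order_trans)
    show "((\<lambda>n. norm (T (P' n (x n))) - norm (Q n (T (P' n (x n))))) \<longlongrightarrow> 0) F"
      by (rule squeeze, use ev in eventually_elim) (metis P' con con_R con_S order_refl order_trans)
    show "\<forall>\<^sub>F n in F. Q n \<in> ?R" using ev by eventually_elim simp
  qed
  \<comment> \<open>With \<open>p = P' n (x n)\<close> and \<open>w = Q n (T p)\<close>, the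
    expression \<open>T ((p - T p) + (T p - w)) - (T p - w)\<close> collapses to
    \<open>w - T w\<close>.\<close>
  ultimately have "weak_tendsto (\<lambda>n. T ((P' n (x n) - T (P' n (x n)))
      + (T (P' n (x n)) - Q n (T (P' n (x n)))))
      - (T (P' n (x n)) - Q n (T (P' n (x n))))) (T (0 + 0) - 0) F"
    by (intro weak_tendsto_diff weak_tendsto_add weak_tendsto_blinfun_apply)
  then have "weak_tendsto (\<lambda>n. Q n (T (P' n (x n))) - T (Q n (T (P' n (x n))))) 0 F"
    by (simp add: blinfun.diff_right)
  then show "weak_tendsto (\<lambda>n. W n (x n) - T (W n (x n))) 0 F"
  proof (rule weak_tendsto_eventually_cong)
    show "\<forall>\<^sub>F n in F. Q n (T (P' n (x n))) - T (Q n (T (P' n (x n)))) =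
      W n (x n) - T (W n (x n))"
      using ev by eventually_elim simp
  qed
qed

lemma weak_limits_common_fixed_points:
  fixes x :: "'i \<Rightarrow> 'a::real_normed_vector" and T :: "'a \<Rightarrow>\<^sub>L 'a"
  assumes "weak_tendsto x l F" "weak_tendsto (\<lambda>n. x n - T (x n)) 0 F" "F \<noteq> bot"
  shows "T l = l"
proof -
  have "weak_tendsto (\<lambda>n. x n - T (x n)) (l - T l) F"
    by (intro weak_tendsto_diff weak_tendsto_blinfun_apply assms(1))
  then show ?thesis
    using weak_tendsto_unique[OF _ assms(2,3)] by fastforce
qed

section \<open>Induction on the set of generators\<close>

lemma property_W_generated_semigroup:
  fixes G :: "('a::real_normed_vector \<Rightarrow>\<^sub>L 'a) set"
  assumes refl: "reflexive_space TYPE('a)"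
    and comp: "\<And>x::'a. x \<noteq> 0 \<Longrightarrow> compact (norming_functionals x)"
    and "finite G" and "\<And>T. T \<in> G \<Longrightarrow> W_contraction T"
  shows "property_W (generated_semigroup G)"
  using assms(3,4)
proof (induction G rule: finite_psubset_induct)
  case (psubset G)
  have con: "contraction A" if "A \<in> generated_semigroup G" for A
    using contraction_generated_semigroup[OF that] psubset.prems by (auto simp: W_contraction_def)
  have IH: "property_W (generated_semigroup (G - {T}))" if "T \<in> G" for T
    using that psubset.prems by (intro psubset.IH) auto
  show ?case
    unfolding property_W_def weakly_converges_to_def
  proof (intro allI impI)
    fix x :: "nat \<Rightarrow> 'a" and W :: "nat \<Rightarrow> 'a \<Rightarrow>\<^sub>L 'a" and f :: "'a \<Rightarrow>\<^sub>L real"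
    assume "bounded (range x)" and "\<forall>n. W n \<in> generated_semigroup G"
      and lim: "(\<lambda>n. norm (x n) - norm (W n (x n))) \<longlonglongrightarrow> 0"
    then obtain M where M: "\<And>n. norm (x n) \<le> M" and W: "\<And>n. W n \<in> generated_semigroup G"
      by (auto simp: bounded_iff)
    show "(\<lambda>n. f (x n - W n (x n))) \<longlonglongrightarrow> f 0"
    proof (rule ccontr)
      assume "\<not> ?thesis"
      then obtain \<epsilon> where "\<epsilon> > 0"
        and \<epsilon>: "\<not> (\<forall>\<^sub>F n in sequentially. \<bar>f (x n - W n (x n))\<bar> < \<epsilon>)"
        by (auto simp: tendsto_iff dist_real_def)
      \<comment> \<open>Restricting to the bad indices gives a proper filter because they recur
        beyond every bound. No proper refinement of it can carry weak convergence of the differences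
        to \<open>0\<close>, so producing one refutes the assumption.\<close>
      define B where "B = {n. \<epsilon> \<le> \<bar>f (x n - W n (x n))\<bar>}"
      define F where "F = inf sequentially (principal B)"
      have "F \<noteq> bot"
        using \<epsilon> unfolding F_def B_def trivial_limit_def eventually_inf_principal
        by (simp add: not_le)
      have no_limit: False if "F' \<le> F" "F' \<noteq> bot" "weak_tendsto (\<lambda>n. x n - W n (x n)) 0 F'" for F'
      proof -
        have "((\<lambda>n. f (x n - W n (x n))) \<longlongrightarrow> 0) F'"
          using that(3) unfolding weak_tendsto_def by fastforce
        then have "\<forall>\<^sub>F n in F'. \<bar>f (x n - W n (x n))\<bar> < \<epsilon>"
          using \<open>\<epsilon> > 0\<close> unfolding tendsto_iff by (simp add: dist_real_def)
        moreover have "\<forall>\<^sub>F n in F'. \<epsilon> \<le> \<bar>f (x n - W n (x n))\<bar>"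
          by (rule filter_leD[OF that(1)])
            (auto simp: F_def B_def eventually_inf_principal)
        ultimately have "\<forall>\<^sub>F n in F'. False" by eventually_elim simp
        then show False using that(2) by (simp add: trivial_limit_def)
      qed
      have lim': "((\<lambda>n. norm (x n) - norm (W n (x n))) \<longlongrightarrow> 0) F'" if "F' \<le> F" for F'
        using tendsto_mono[OF order_trans[OF that] lim] by (simp add: F_def)
      \<comment> \<open>If words avoiding \<open>T\<close> kept recurring along \<open>F\<close>,
        restricting \<open>F\<close> to them would give a forbidden refinement by the induction
        hypothesis.\<close>
      have occ: "\<forall>\<^sub>F n in F. W n \<notin> generated_semigroup (G - {T})" if "T \<in> G" for T
      proof (rule ccontr)
        define F' where "F' = inf F (principal {n. W n \<in> generated_semigroup (G - {T})})"
        assume "\<not> ?thesis"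
        then have "F' \<noteq> bot"
          by (simp add: F'_def trivial_limit_def eventually_inf_principal)
        moreover have "F' \<le> F" by (simp add: F'_def)
        moreover have "weak_tendsto (\<lambda>n. x n - W n (x n)) 0 F'"
          by (rule property_W_filter[OF IH[OF that] M _ lim'[OF \<open>F' \<le> F\<close>]])
            (simp add: F'_def eventually_inf_principal)
        ultimately show False using no_limit by blast
      qed
      obtain l F1 where F1: "F1 \<le> F" "F1 \<noteq> bot" and l: "weak_tendsto x l F1"
        by (rule reflexive_space_weak_subfilter[OF refl \<open>F \<noteq> bot\<close> M])
      have bound: "norm (W n (x n)) \<le> M" for n
        using con[OF W] M unfolding contraction_def by (meson order_trans)
      obtain m F2 where F2: "F2 \<le> F1" "F2 \<noteq> bot" and m: "weak_tendsto (\<lambda>n. W n (x n)) m F2"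
        by (rule reflexive_space_weak_subfilter[OF refl F1(2) bound])
      have "F2 \<le> F" using F1 F2 by simp
      have l': "weak_tendsto x l F2" using l F2(1) by (rule weak_tendsto_mono)
      have fixed: "T l = l \<and> T m = m" if "T \<in> G" for T :: "'a \<Rightarrow>\<^sub>L 'a"
        using weak_tendsto_asymptotically_fixed[OF that psubset.prems IH[OF that] M W
            filter_leD[OF \<open>F2 \<le> F\<close> occ[OF that]] lim'[OF \<open>F2 \<le> F\<close>]]
          weak_limits_common_fixed_points[OF l' _ F2(2)] weak_limits_common_fixed_points[OF m _ F2(2)]
        by blast
      \<comment> \<open>Fixed points of all generators are fixed by every word, which is the
        invariance needed to identify \<open>l\<close> with \<open>m\<close>.\<close>
      have "W n (l - m) = l - m" for n
        using generated_semigroup_fixed_point[OF W] fixed by (simp add: blinfun.diff_right)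
      then have "l = m"
        using weak_limits_eq[OF F2(2) M con[OF W] _ l' m comp] by blast
      then have "weak_tendsto (\<lambda>n. x n - W n (x n)) 0 F2"
        using weak_tendsto_diff[OF l' m] by simp
      then show False using no_limit \<open>F2 \<le> F\<close> F2(2) by blast
    qed
  qed
qed

section \<open>Random products\<close>

text \<open>The inequality \<open>m < n\<close> is strict because the semigroup contains only
  nonempty products; the indices of the connecting word start at \<open>m + 1\<close>, so
  \<open>r 0\<close> never enters.\<close>

lemma iterated_product_suffix:
  assumes "m < n" and "\<And>k. 1 \<le> k \<Longrightarrow> T (r k) \<in> G"
  shows "\<exists>A \<in> generated_semigroup G. \<forall>x.
    iterated_product T r n x = blinfun_apply A (iterated_product T r m x)"
  using assms(1)
proof (induction n)
  case (Suc n)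
  have gen: "T (r (Suc n)) \<in> generated_semigroup G"
    by (intro generated_semigroup.generator assms(2)) simp
  show ?case
  proof (cases "m = n")
    case True
    then show ?thesis using gen by (intro bexI[of _ "T (r (Suc n))"]) auto
  next
    case False
    then obtain A where "A \<in> generated_semigroup G"
      "\<And>x. iterated_product T r n x = blinfun_apply A (iterated_product T r m x)"
      using Suc by (metis less_antisym)
    then show ?thesis
      using gen by (intro bexI[of _ "T (r (Suc n)) o\<^sub>L A"]) (auto intro: generated_semigroup.compose)
  qed
qed simp

text \<open>The norms along the orbit decrease, hence form a Cauchy sequence. Late members
  \<open>u m\<close> and \<open>u n\<close> are joined by one word with small norm loss, and the
  uniform form of (W) makes \<open>f (u m) - f (u n)\<close> small.\<close>

lemma weakly_converges_iterated_product:
  fixes T :: "nat \<Rightarrow> 'a::real_normed_vector \<Rightarrow>\<^sub>L 'a"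
  assumes refl: "reflexive_space TYPE('a)"
    and W: "property_W (generated_semigroup G)"
    and con: "\<And>A. A \<in> G \<Longrightarrow> contraction A"
    and mem: "\<And>k. 1 \<le> k \<Longrightarrow> T (r k) \<in> G"
  shows "\<exists>y. weakly_converges_to (\<lambda>n. iterated_product T r n x) y"
proof -
  define u where "u n = iterated_product T r n x" for n
  have suffix: "\<exists>A \<in> generated_semigroup G. u n = A (u m)" if "m < n" for m n
    using iterated_product_suffix[where T = T and r = r, OF that mem] by (auto simp: u_def)
  have dec: "norm (u n) \<le> norm (u m)" if "m \<le> n" for m n
    using that suffix[of m n] contraction_generated_semigroup[OF _ con]
    by (cases "m = n") (auto simp: contraction_def)
  have bound: "norm (u n) \<le> norm x" for n
    using dec[of 0 n] by (simp add: u_def)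
  have "decseq (\<lambda>n. norm (u n))" using dec by (simp add: decseq_def)
  then have "convergent (\<lambda>n. norm (u n))"
    using bound by (intro Bseq_monoseq_convergent BseqI'[of _ "norm x"]) (auto simp: decseq_imp_monoseq)
  then have cau_norm: "Cauchy (\<lambda>n. norm (u n))" by (rule convergent_Cauchy)
  have "Cauchy (\<lambda>n. f (u n))" for f :: "'a \<Rightarrow>\<^sub>L real"
  proof (rule metric_CauchyI)
    fix \<epsilon> :: real assume "\<epsilon> > 0"
    then obtain \<delta> where \<delta>: "\<delta> > 0"
      "\<And>v A. A \<in> generated_semigroup G \<Longrightarrow> norm v \<le> norm x \<Longrightarrow>
        \<bar>norm v - norm (blinfun_apply A v)\<bar> < \<delta> \<Longrightarrow> \<bar>f (v - blinfun_apply A v)\<bar> < \<epsilon>"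
      using property_W_uniform[OF W, of \<epsilon> "norm x" f] by metis
    obtain k where k: "\<And>m n. m \<ge> k \<Longrightarrow> n \<ge> k \<Longrightarrow> \<bar>norm (u m) - norm (u n)\<bar> < \<delta>"
      using metric_CauchyD[OF cau_norm \<delta>(1)] by (auto simp: dist_real_def)
    have close: "\<bar>f (u m) - f (u n)\<bar> < \<epsilon>" if mn: "k \<le> m" "m < n" for m n
    proof -
      obtain A where A: "A \<in> generated_semigroup G" "u n = A (u m)"
        using suffix[OF mn(2)] by blast
      have "\<bar>norm (u m) - norm (A (u m))\<bar> < \<delta>"
        using k[of m n] mn A(2) by simp
      then show ?thesis
        using \<delta>(2)[OF A(1) bound[of m]] A(2) by (simp add: blinfun.diff_right)
    qed
    have "dist (f (u m)) (f (u n)) < \<epsilon>" if "k \<le> m" "k \<le> n" for m n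
      using close[of m n] close[of n m] that \<open>\<epsilon> > 0\<close>
      by (cases m n rule: linorder_cases) (auto simp: dist_real_def abs_minus_commute)
    then show "\<exists>k. \<forall>m\<ge>k. \<forall>n\<ge>k. dist (f (u m)) (f (u n)) < \<epsilon>" by blast
  qed
  then have "\<forall>f :: 'a \<Rightarrow>\<^sub>L real. \<exists>c. (\<lambda>n. f (u n)) \<longlonglongrightarrow> c"
    using Cauchy_convergent convergent_def by blast
  then obtain \<phi> :: "('a \<Rightarrow>\<^sub>L real) \<Rightarrow> real"
    where "\<And>f. (\<lambda>n. blinfun_apply f (u n)) \<longlonglongrightarrow> \<phi> f" by metis
  from reflexive_space_limit_functional[OF refl sequentially_bot bound this]
  show ?thesis by (auto simp: weakly_converges_to_iff u_def)
qed

theorem theorem5: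
  fixes T :: "nat \<Rightarrow> 'a::banach \<Rightarrow>\<^sub>L 'a" and N :: nat
  assumes "reflexive_space TYPE('a)"
    and "\<And>x::'a. x \<noteq> 0 \<Longrightarrow> compact (norming_functionals x)"
    and "1 \<le> N"
    and "\<And>j. j \<in> {1..N} \<Longrightarrow> W_contraction (T j)"
  shows "property_W (generated_semigroup (T ` {1..N})) \<and>
    (\<forall>S. random_product N T S \<longrightarrow>
       (\<forall>x. \<exists>y. weakly_converges_to (\<lambda>n. blinfun_apply (S n) x) y))"
proof (intro conjI allI impI)
  show W: "property_W (generated_semigroup (T ` {1..N}))"
    using assms(4) by (intro property_W_generated_semigroup[OF assms(1,2)]) auto
  fix S x assume "random_product N T S"
  then obtain r where r: "r ` {1..} = {1..N}" and S: "\<And>n. n \<ge> 1 \<Longrightarrow> S n = iterated_product T r n"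
    unfolding random_product_def by blast
  have mem: "T (r k) \<in> T ` {1..N}" if "1 \<le> k" for k
    using r that by (intro imageI) (auto simp flip: r)
  have con: "contraction A" if "A \<in> T ` {1..N}" for A
    using that assms(4) by (auto simp: W_contraction_def)
  obtain y where y: "weakly_converges_to (\<lambda>n. iterated_product T r n x) y"
    using weakly_converges_iterated_product[where T = T and r = r, OF assms(1) W con mem] by blast
  \<comment> \<open>Equality holds only from index 1 on, since \<open>S 0\<close> is arbitrary; the
    weak limit is unaffected.\<close>
  have "\<forall>\<^sub>F n in sequentially. iterated_product T r n x = S n x"
    using eventually_ge_at_top[of 1] by eventually_elim (simp add: S)
  then have "weakly_converges_to (\<lambda>n. S n x) y"
    using y weak_tendsto_eventually_cong[of "\<lambda>n. iterated_product T r n x" y sequentially "\<lambda>n. S n x"]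
    by (simp add: weakly_converges_to_iff)
  then show "\<exists>y. weakly_converges_to (\<lambda>n. S n x) y" ..
qed

end
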